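(* For every integer $n\ge 3$, we have $$\eta(C_n)=\begin{cases}0, & \text{if } n\in\{3,4,5,7\};\\ n/2, & \text{if } n\ge 6 \text{ and } n \text{ is even};\\ (n-3)/2, & \text{if } n\ge 9 \text{ and } n \text{ is odd}.\end{cases}$$
   Context: $C_n$ denotes the cycle on $n$ vertices. A matching covers a set $S$ of vertices if every vertex of $S$ is an endpoint of an edge of the matching. A matching is maximal if it is not properly contained in another matching. A set $S\subseteq V(G)$ is equimatchable in a graph $G$ if all maximal matchings of $G$ covering $S$ are of the same size (in particular, a set covered by no matching is vacuously equimatchable). The equimatchability defect $\eta(G)$ is the minimum size of an equimatchable set of $G$. *)

theory Defs
  imports Complex_Main
begin

text \<open>A graph is given by its vertex set \<open>V\<close> and its set \<open>E\<close> of edges, an edge being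
  the set of its two endpoints.\<close>

definition simple_graph :: "'a set \<Rightarrow> 'a set set \<Rightarrow> bool" where
  "simple_graph V E \<longleftrightarrow> finite V \<and> (\<forall>e\<in>E. e \<subseteq> V \<and> card e = 2)"

definition matching :: "'a set set \<Rightarrow> 'a set set \<Rightarrow> bool" where
  "matching E M \<longleftrightarrow> M \<subseteq> E \<and> (\<forall>e\<in>M. \<forall>f\<in>M. e \<noteq> f \<longrightarrow> e \<inter> f = {})"

definition maximal_matching :: "'a set set \<Rightarrow> 'a set set \<Rightarrow> bool" where
  "maximal_matching E M \<longleftrightarrow> matching E M \<and> \<not> (\<exists>M'. matching E M' \<and> M \<subset> M')"

definition covers :: "'a set set \<Rightarrow> 'a set \<Rightarrow> bool" where
  "covers M S \<longleftrightarrow> (\<forall>v\<in>S. \<exists>e\<in>M. v \<in> e)"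

definition equimatchable :: "'a set \<Rightarrow> 'a set set \<Rightarrow> 'a set \<Rightarrow> bool" where
  "equimatchable V E S \<longleftrightarrow> S \<subseteq> V \<and>
     (\<forall>M N. maximal_matching E M \<and> covers M S \<and> maximal_matching E N \<and> covers N S
        \<longrightarrow> card M = card N)"

text \<open>Meaningful for finite graphs, where the minimum is attained: see
  \<open>equimatch_defect_attained\<close> below.\<close>

definition equimatch_defect :: "'a set \<Rightarrow> 'a set set \<Rightarrow> nat" where
  "equimatch_defect V E = (LEAST k. \<exists>S. equimatchable V E S \<and> card S = k)"

text \<open>This is the cycle with \<open>n\<close> vertices only for \<open>n \<ge> 3\<close>; it degenerates otherwise.\<close>

definition cycle_verts :: "nat \<Rightarrow> nat set" where
  "cycle_verts n = {..<n}"

definition cycle_edges :: "nat \<Rightarrow> nat set set" where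
  "cycle_edges n = {{i, (i + 1) mod n} | i. i < n}"

lemma simple_graph_cycle:
  assumes "n \<ge> 3"
  shows "simple_graph (cycle_verts n) (cycle_edges n)"
proof -
  have "i \<noteq> (i + 1) mod n" if "i < n" for i
    using that assms by (cases "i + 1 = n") auto
  then show ?thesis
    using assms by (fastforce simp: simple_graph_def cycle_verts_def cycle_edges_def card_insert_if)
qed

lemma equimatchable_verts:
  assumes "simple_graph V E"
  shows "equimatchable V E V"
proof -
  have size: "2 * card M = card V" if "matching E M" "covers M V" for M
  proof -
    have sub: "e \<subseteq> V" "card e = 2" if "e \<in> M" for e
      using that \<open>matching E M\<close> assms by (auto simp: matching_def simple_graph_def)
    have un: "\<Union>M = V"
      using sub(1) \<open>covers M V\<close> by (auto simp: covers_def)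
    have "finite V"
      using assms by (simp add: simple_graph_def)
    then have "finite M"
      using un by (metis finite_UnionD)
    then have "2 * card M = card (\<Union>M)"
      using sub(2) un \<open>finite V\<close> \<open>matching E M\<close>
      by (intro card_partition) (simp_all add: matching_def)
    then show ?thesis
      using un by simp
  qed
  have "card M = card N"
    if "matching E M" "covers M V" "matching E N" "covers N V" for M N
    using size[OF that(1,2)] size[OF that(3,4)] by simp
  then show ?thesis
    by (auto simp: equimatchable_def maximal_matching_def)
qed

lemma equimatch_defect_attained:
  assumes "simple_graph V E"
  shows "\<exists>S. equimatchable V E S \<and> card S = equimatch_defect V E"
  unfolding equimatch_defect_def
  by (rule LeastI_ex) (use equimatchable_verts[OF assms] in blast)

end

theory Submission
  imports Defs
begin

text \<open>A matching of \<open>C\<^sub>n\<close> is maximal iff the set \<open>U\<close> of vertices that it misses is independent,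
  and a matching missing exactly the vertices of \<open>U\<close> has size \<open>(n - card U) / 2\<close>.  Hence
  \<open>S\<close> is equimatchable iff all the sets \<open>U\<close> disjoint from \<open>S\<close> that arise in this way have
  the same size.  A nonempty set arises iff any two cyclically consecutive members of it have an
  odd distance, at least 3: then the path between them has a perfect matching.  These sets are
  called exposable below, and \<open>exposable_maximal_matching\<close> provides the matchings.

  Upper bounds: it suffices to find \<open>S\<close> such that every maximal matching covering \<open>S\<close> has the
  largest conceivable size \<open>n div 2\<close>.  For \<open>n \<in> {3, 4, 5, 7}\<close> the empty set does, since each
  edge of a maximal matching meets only three edges of the cycle, itself included, which gives
  \<open>n \<le> 3 * card M\<close>.  For even \<open>n\<close> the even vertices do, since no edge covers two of them.  For
  \<open>n = 2 * m + 1\<close> the vertices \<open>0, 2, \<dots>, 2 * m - 4\<close> do: they require \<open>m - 1\<close> different edges,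
  and by maximality some edge of the matching meets \<open>{2 * m - 2, 2 * m - 1}\<close>, while no edge
  that does so covers one of these vertices.

  Lower bounds: for even \<open>n\<close> the empty set is exposable, so the complement of an equimatchable
  set contains no exposable pair; \<open>exposable_pair_in_large_set\<close> says that such a
  complement has at most \<open>n / 2\<close> vertices.  For odd \<open>n\<close> every single vertex is exposable, so the
  complement contains no exposable triple, and by \<open>exposable_triple_in_large_set\<close> it has
  at most \<open>m + 2\<close> vertices.

  For the triple, let \<open>T\<close> be a set of at least \<open>m + 3\<close> vertices, but not of all of them, and cut the
  cycle just before some \<open>r \<in> T\<close> whose predecessor is not in \<open>T\<close>.  If \<open>T\<close>
  has an isolated vertex, a counting argument yields a triple through that vertex.  Otherwise, in the
  linear order of the cut, the first two and the last two members of \<open>T\<close> are adjacent pairs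
  and every vertex of \<open>T\<close> at distance at least 3 from the first and the last one extends to a
  triple, because a choice between two adjacent vertices allows both parities.\<close>

section \<open>Maximal matchings in simple graphs\<close>

lemma maximal_matching_iff:
  assumes "{} \<notin> E"
  shows "maximal_matching E M \<longleftrightarrow> matching E M \<and> (\<forall>e\<in>E. e \<inter> \<Union>M \<noteq> {})"
proof
  assume M: "maximal_matching E M"
  have "e \<inter> \<Union>M \<noteq> {}" if "e \<in> E" for e
  proof
    assume disj: "e \<inter> \<Union>M = {}"
    then have "matching E (insert e M)"
      using M that unfolding maximal_matching_def matching_def by blast
    moreover have "e \<notin> M"
      using disj that assms by (metis Int_absorb2 Union_upper)
    ultimately show False
      using M unfolding maximal_matching_def by blast
  qed
  then show "matching E M \<and> (\<forall>e\<in>E. e \<inter> \<Union>M \<noteq> {})"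
    using M by (simp add: maximal_matching_def)
next
  assume M: "matching E M \<and> (\<forall>e\<in>E. e \<inter> \<Union>M \<noteq> {})"
  have False if M': "matching E M'" "M \<subset> M'" for M'
  proof -
    obtain e where e: "e \<in> M'" "e \<notin> M"
      using M' by blast
    then have "e \<inter> \<Union>M \<noteq> {}"
      using M M'(1) by (auto simp: matching_def)
    then obtain f where f: "f \<in> M" "e \<inter> f \<noteq> {}"
      by blast
    then have "f \<in> M'" "e \<noteq> f"
      using e M'(2) by auto
    with f(2) show False
      using e(1) M'(1) by (simp add: matching_def)
  qed
  then show "maximal_matching E M"
    using M by (auto simp: maximal_matching_def)
qed

lemma matching_card_Union:
  assumes "simple_graph V E" "matching E M"
  shows "\<Union>M \<subseteq> V" "finite M" "2 * card M = card (\<Union>M)"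
proof -
  have sub: "e \<subseteq> V" "card e = 2" if "e \<in> M" for e
    using that assms by (auto simp: matching_def simple_graph_def)
  show V: "\<Union>M \<subseteq> V"
    using sub(1) by blast
  have fin: "finite (\<Union>M)"
    using V assms(1) finite_subset by (auto simp: simple_graph_def)
  then show "finite M"
    by (rule finite_UnionD)
  then show "2 * card M = card (\<Union>M)"
    using sub(2) fin assms(2) by (intro card_partition) (simp_all add: matching_def)
qed

text \<open>Only the edges meeting \<open>S\<close> are counted, so that edges known to avoid \<open>S\<close> improve the resulting
  bound on the size of \<open>M\<close>.\<close>

lemma card_independent_covered_le:
  assumes "finite M" "covers M S"
    and ind: "\<And>e u v. e \<in> M \<Longrightarrow> u \<in> S \<inter> e \<Longrightarrow> v \<in> S \<inter> e \<Longrightarrow> u = v"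
  shows "card S \<le> card {e \<in> M. e \<inter> S \<noteq> {}}"
proof -
  obtain g where g: "\<And>v. v \<in> S \<Longrightarrow> g v \<in> M \<and> v \<in> g v"
    using assms(2) unfolding covers_def by metis
  have "inj_on g S"
    by (rule inj_onI) (metis IntI g ind)
  moreover have "g ` S \<subseteq> {e \<in> M. e \<inter> S \<noteq> {}}"
    using g by blast
  ultimately show ?thesis
    using assms(1) by (intro card_inj_on_le) auto
qed

section \<open>Matchings of a cycle\<close>

lemma empty_notin_cycle_edges: "{} \<notin> cycle_edges n"
  by (auto simp: cycle_edges_def)

lemma Suc_mod_inj:
  assumes "i < n" "j < n" "(i + 1) mod n = (j + 1) mod n"
  shows "i = (j::nat)"
proof -
  have "(k + 1) mod n = (if k + 1 = n then 0 else k + 1)" if "k < n" for k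
    using that by auto
  with assms show ?thesis
    by (auto split: if_splits)
qed

lemma pred_mod:
  assumes "i < n"
  obtains j where "j < n" "(j + 1) mod n = (i::nat)"
  using assms by (cases i) (auto intro: that[of "n - 1"] that[of "i - 1"])

lemma cycle_matching_card_le:
  assumes "n \<ge> 3" "maximal_matching (cycle_edges n) M"
  shows "2 * card M \<le> n"
proof -
  have "matching (cycle_edges n) M"
    using assms(2) by (simp add: maximal_matching_def)
  note M = matching_card_Union[OF simple_graph_cycle[OF assms(1)] this]
  have "card (\<Union>M) \<le> card (cycle_verts n)"
    by (rule card_mono[OF _ M(1)]) (simp add: cycle_verts_def)
  with M(3) show ?thesis
    by (simp add: cycle_verts_def)
qed

text \<open>By maximality every edge of the cycle is one of the at most three edges that meet some edge
  of \<open>M\<close>.\<close>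

lemma cycle_maximal_matching_card_ge:
  assumes "n \<ge> 3" "maximal_matching (cycle_edges n) M"
  shows "n \<le> 3 * card M"
proof -
  have M: "matching (cycle_edges n) M" "\<forall>e\<in>cycle_edges n. e \<inter> \<Union>M \<noteq> {}"
    using assms(2) by (simp_all add: maximal_matching_iff[OF empty_notin_cycle_edges])
  have "M \<subseteq> (\<lambda>i. {i, (i + 1) mod n}) ` {..<n}"
    using M(1) unfolding matching_def cycle_edges_def by blast
  then obtain F where F: "F \<subseteq> {..<n}" "inj_on (\<lambda>i. {i, (i + 1) mod n}) F"
    "M = (\<lambda>i. {i, (i + 1) mod n}) ` F"
    by (auto simp: subset_image_inj)
  have finF: "finite F"
    using F(1) finite_subset by blast
  have "{..<n} \<subseteq> (\<Union>j\<in>F. {j, (j + 1) mod n, (j + (n - 1)) mod n})"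
  proof
    fix i assume i: "i \<in> {..<n}"
    then have "{i, (i + 1) mod n} \<in> cycle_edges n"
      by (auto simp: cycle_edges_def)
    then obtain j where j: "j \<in> F" "{i, (i + 1) mod n} \<inter> {j, (j + 1) mod n} \<noteq> {}"
      using M(2) F(3) by blast
    then have jn: "j < n"
      using F(1) by blast
    have "i = (j + (n - 1)) mod n" if "j = (i + 1) mod n"
      using i that by (cases "i + 1 = n") auto
    moreover have "i = j" if "(i + 1) mod n = (j + 1) mod n"
      using that i jn Suc_mod_inj by auto
    ultimately have "i \<in> {j, (j + 1) mod n, (j + (n - 1)) mod n}"
      using j(2) by auto
    with j(1) show "i \<in> (\<Union>j\<in>F. {j, (j + 1) mod n, (j + (n - 1)) mod n})"
      by blast
  qed
  then have "card {..<n} \<le> card (\<Union>j\<in>F. {j, (j + 1) mod n, (j + (n - 1)) mod n})"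
    using finF by (intro card_mono) auto
  also have "\<dots> \<le> (\<Sum>j\<in>F. card {j, (j + 1) mod n, (j + (n - 1)) mod n})"
    by (rule card_UN_le[OF finF])
  also have "\<dots> \<le> (\<Sum>j\<in>F. 3)"
    by (intro sum_mono) (simp add: card_insert_if)
  also have "\<dots> = 3 * card M"
    using F by (simp add: card_image)
  finally show ?thesis
    by simp
qed

section \<open>Sets of vertices missed by maximal matchings\<close>

text \<open>The parity condition says that any two members \<open>u < u'\<close> of \<open>U\<close> with no member in between
  have an odd distance: passing from \<open>u\<close> to \<open>u'\<close> increases the number of smaller members by one.  As
  \<open>n + card U\<close> is even, the distance from the largest member around to the smallest is odd,
  too.  In this form the condition covers sets of every size, the empty one included.\<close>

definition exposable :: "nat \<Rightarrow> nat set \<Rightarrow> bool" where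
  "exposable n U \<longleftrightarrow> U \<subseteq> {..<n} \<and> even (n + card U) \<and>
     (\<exists>c. \<forall>u\<in>U. even (c + u + card {w \<in> U. w < u})) \<and> (\<forall>u\<in>U. (u + 1) mod n \<notin> U)"

lemma inj_on_shift_mod: "inj_on (\<lambda>i. (r + i) mod n) {..<n::nat}"
proof (rule inj_onI)
  fix i j assume *: "i \<in> {..<n}" "j \<in> {..<n}" "(r + i) mod n = (r + j) mod n"
  show "i = j"
  proof (rule linorder_cases[of i j])
    assume "i < j"
    then have "n dvd j - i"
      using *(3) mod_eq_dvd_iff_nat[of "r + i" "r + j" n] by simp
    then show ?thesis
      using \<open>i < j\<close> *(2) by (auto dest: dvd_imp_le)
  next
    assume "j < i"
    then have "n dvd i - j"
      using *(3) mod_eq_dvd_iff_nat[of "r + j" "r + i" n] by simp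
    then show ?thesis
      using \<open>j < i\<close> *(1) by (auto dest: dvd_imp_le)
  qed
qed

lemma shift_mod_image: "(\<lambda>i. (r + i) mod n) ` {..<n::nat} = {..<n}"
  by (rule endo_inj_surj[OF _ _ inj_on_shift_mod]) auto

text \<open>Let \<open>p i\<close> be the parity condition of \<open>exposable\<close> at an arbitrary position \<open>i\<close>.  It
  alternates along the cycle except that it does not change on leaving a member of \<open>U\<close>, and it holds at
  all members of \<open>U\<close>.  So it holds at the first vertex of each path between consecutive members,
  fails at the last one, and the edges starting at the vertices outside \<open>U\<close> where it holds match the paths
  perfectly.  As exposable sets are found after rotating the cycle by some \<open>r\<close>,
  the matching is rotated as well.\<close>

lemma exposable_maximal_matching:
  assumes n: "n \<ge> 3" and U: "exposable n U"
  shows "\<exists>M. maximal_matching (cycle_edges n) M \<and>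
    \<Union>M = (\<lambda>i. (r + i) mod n) ` ({..<n} - U)"
proof -
  obtain c where sub: "U \<subseteq> {..<n}" and par: "even (n + card U)"
    and c: "\<And>u. u \<in> U \<Longrightarrow> even (c + u + card {w \<in> U. w < u})"
    and ind: "\<And>u. u \<in> U \<Longrightarrow> (u + 1) mod n \<notin> U"
    using U unfolding exposable_def by blast
  define p where "p i \<longleftrightarrow> even (c + i + card {w \<in> U. w < i})" for i
  define s where "s i = (i + 1) mod n" for i
  define \<sigma> where "\<sigma> i = (r + i) mod n" for i
  have finU: "finite U"
    using sub finite_subset by blast
  have p_Suc: "p (Suc i) \<longleftrightarrow> (if i \<in> U then p i else \<not> p i)" for i
  proof (cases "i \<in> U")
    case True
    then have "{w \<in> U. w < Suc i} = insert i {w \<in> U. w < i}"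
      by auto
    then show ?thesis
      using True finU by (simp add: p_def)
  next
    case False
    then have "{w \<in> U. w < Suc i} = {w \<in> U. w < i}"
      by (auto simp: less_Suc_eq)
    then show ?thesis
      using False by (simp add: p_def)
  qed
  have "{w \<in> U. w < n} = U"
    using sub by auto
  \<comment> \<open>The parities on the two sides of the point where the vertex numbers wrap around agree.\<close>
  then have "p n \<longleftrightarrow> p 0"
    using par by (auto simp: p_def)
  then have "p (s i) \<longleftrightarrow> p (Suc i)" if "i < n" for i
    using that by (cases "Suc i = n") (simp_all add: s_def)
  with p_Suc have p_s: "p (s i) \<longleftrightarrow> (if i \<in> U then p i else \<not> p i)" if "i < n" for i
    using that by simp
  have pU: "p u" if "u \<in> U" for u
    using c that by (simp add: p_def)
  define F where "F = {i. i < n \<and> i \<notin> U \<and> p i}"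
  define M where "M = (\<lambda>i. \<sigma> ` {i, s i}) ` F"
  have sn: "s i < n" for i
    using n by (simp add: s_def)
  have F_s: "s i \<notin> U" "s i \<notin> F" if "i \<in> F" for i
    using that p_s[of i] pU[of "s i"] by (auto simp: F_def)
  have F_pred: "\<exists>j\<in>F. s j = i" if i: "i < n" "i \<notin> U" "i \<notin> F" for i
  proof -
    obtain j where j: "j < n" "s j = i"
      using pred_mod[OF i(1)] unfolding s_def by blast
    have "\<not> p i"
      using i by (simp add: F_def)
    then have "j \<in> F"
      using j p_s[OF j(1)] pU[of j] by (auto simp: F_def split: if_splits)
    with j(2) show ?thesis
      by blast
  qed
  have inj: "inj_on \<sigma> {..<n}"
    unfolding \<sigma>_def by (rule inj_on_shift_mod)
  have \<sigma>_s: "(\<sigma> i + 1) mod n = \<sigma> (s i)" for i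
    unfolding \<sigma>_def s_def by presburger
  have edges: "cycle_edges n = (\<lambda>i. \<sigma> ` {i, s i}) ` {..<n}"
  proof -
    have "cycle_edges n = (\<lambda>i. {i, (i + 1) mod n}) ` (\<sigma> ` {..<n})"
      unfolding \<sigma>_def shift_mod_image by (auto simp: cycle_edges_def)
    also have "\<dots> = (\<lambda>i. \<sigma> ` {i, s i}) ` {..<n}"
      by (simp only: image_image image_insert image_empty \<sigma>_s)
    finally show ?thesis .
  qed
  have "matching (cycle_edges n) M"
    unfolding matching_def
  proof (intro conjI ballI impI)
    show "M \<subseteq> cycle_edges n"
      by (auto simp: M_def edges F_def)
    fix e f assume "e \<in> M" "f \<in> M" "e \<noteq> f"
    then obtain i j where ij: "i \<in> F" "j \<in> F" "i \<noteq> j" "e = \<sigma> ` {i, s i}" "f = \<sigma> ` {j, s j}"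
      unfolding M_def by auto
    then have "i < n" "j < n"
      by (simp_all add: F_def)
    then have "{i, s i} \<inter> {j, s j} = {}"
      using ij F_s(2) Suc_mod_inj[of i n j] by (auto simp: s_def)
    moreover have "e \<inter> f = \<sigma> ` ({i, s i} \<inter> {j, s j})"
      unfolding ij(4,5) using \<open>i < n\<close> \<open>j < n\<close> sn
      by (intro inj_on_image_Int[OF inj, symmetric]) auto
    ultimately show "e \<inter> f = {}"
      by simp
  qed
  moreover have Un: "\<Union>M = \<sigma> ` ({..<n} - U)"
  proof -
    have "(\<Union>i\<in>F. {i, s i}) = {..<n} - U"
      using F_s(1) F_pred sn by (auto simp: F_def)
    then show ?thesis
      unfolding M_def by (auto simp: image_UN[symmetric])
  qed
  moreover have "e \<inter> \<Union>M \<noteq> {}" if "e \<in> cycle_edges n" for e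
  proof -
    obtain i where i: "i < n" "e = \<sigma> ` {i, s i}"
      using \<open>e \<in> cycle_edges n\<close> unfolding edges by blast
    then have "i \<notin> U \<or> s i \<notin> U"
      using ind by (auto simp: s_def)
    then show ?thesis
      unfolding Un i(2) using i(1) sn by blast
  qed
  ultimately show ?thesis
    unfolding maximal_matching_iff[OF empty_notin_cycle_edges] \<sigma>_def by blast
qed

text \<open>Both sets are missed by maximal matchings covering \<open>S\<close>, and a matching that misses
  \<open>k\<close> vertices has size \<open>(n - k) / 2\<close>.\<close>

lemma equimatchable_cycle_exposable_card_eq:
  assumes n: "n \<ge> 3" and S: "equimatchable (cycle_verts n) (cycle_edges n) S"
    and U: "exposable n U" "\<And>u. u \<in> U \<Longrightarrow> (r + u) mod n \<notin> S"
    and W: "exposable n W" "\<And>w. w \<in> W \<Longrightarrow> (q + w) mod n \<notin> S"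
  shows "card U = card W"
proof -
  have ex: "\<exists>M. maximal_matching (cycle_edges n) M \<and> covers M S \<and> 2 * card M + card X = n"
    if X: "exposable n X" "\<And>x. x \<in> X \<Longrightarrow> (k + x) mod n \<notin> S" for X k
  proof -
    obtain M where M: "maximal_matching (cycle_edges n) M"
      "\<Union>M = (\<lambda>i. (k + i) mod n) ` ({..<n} - X)"
      using exposable_maximal_matching[OF n X(1)] by blast
    have "S \<subseteq> (\<lambda>i. (k + i) mod n) ` {..<n}"
      using S by (simp add: equimatchable_def cycle_verts_def shift_mod_image)
    then have "S \<subseteq> \<Union>M"
      using X(2) unfolding M(2) by blast
    then have "covers M S"
      by (auto simp: covers_def)
    have "2 * card M = card (\<Union>M)"
      using matching_card_Union(3)[OF simple_graph_cycle[OF n]] M(1)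
      by (simp add: maximal_matching_def)
    also have "\<dots> = card ({..<n} - X)"
      unfolding M(2) by (rule card_image[OF inj_on_subset[OF inj_on_shift_mod]]) auto
    finally have "2 * card M = n - card X" "card X \<le> n"
      using X(1) card_mono[of "{..<n}" X]
      by (auto simp: exposable_def card_Diff_subset finite_subset)
    with M(1) \<open>covers M S\<close> show ?thesis
      by auto
  qed
  obtain M where M: "maximal_matching (cycle_edges n) M" "covers M S" "2 * card M + card U = n"
    using ex[OF U] by blast
  obtain N where N: "maximal_matching (cycle_edges n) N" "covers N S" "2 * card N + card W = n"
    using ex[OF W] by blast
  have "card M = card N"
    using S M(1,2) N(1,2) unfolding equimatchable_def by blast
  with M(3) N(3) show ?thesis
    by simp
qed

lemma exposable_empty: "even n \<Longrightarrow> exposable n {}"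
  by (simp add: exposable_def)

lemma exposable_singleton: "odd n \<Longrightarrow> n \<ge> 3 \<Longrightarrow> exposable n {0}"
  by (auto simp: exposable_def)

lemma exposable_pair:
  assumes "even n" "x + 3 \<le> y" "y + 3 \<le> x + n" "odd (x + y)" "y < n"
  shows "exposable n {x, y}"
proof -
  have below: "{w \<in> {x, y}. w < x} = {}" "{w \<in> {x, y}. w < y} = {x}"
    using assms(2) by auto
  have "x \<noteq> y"
    using assms(2) by simp
  have "\<forall>u\<in>{x, y}. even (x + u + card {w \<in> {x, y}. w < u})"
    using assms(4) unfolding ball_simps below by simp
  then have "\<exists>c. \<forall>u\<in>{x, y}. even (c + u + card {w \<in> {x, y}. w < u})" ..
  moreover have "(x + 1) mod n = x + 1" "(y + 1) mod n = (if y + 1 = n then 0 else y + 1)"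
    using assms(2,5) by auto
  then have "\<forall>u\<in>{x, y}. (u + 1) mod n \<notin> {x, y}"
    using assms(2,3) by (cases "y + 1 = n") simp_all
  ultimately show ?thesis
    using assms(1,2,5) \<open>x \<noteq> y\<close> unfolding exposable_def by simp
qed

lemma exposable_triple:
  assumes "odd n" "x + 3 \<le> y" "y + 3 \<le> z" "z + 3 \<le> x + n" "odd (x + y)" "odd (y + z)" "z < n"
  shows "exposable n {x, y, z}"
proof -
  have below: "{w \<in> {x, y, z}. w < x} = {}" "{w \<in> {x, y, z}. w < y} = {x}"
    "{w \<in> {x, y, z}. w < z} = {x, y}"
    using assms(2,3) by auto
  have distinct: "x \<noteq> y" "x \<noteq> z" "y \<noteq> z"
    using assms(2,3) by simp_all
  have "even (x + z)"
    using assms(5,6) by simp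
  then have "\<forall>u\<in>{x, y, z}. even (x + u + card {w \<in> {x, y, z}. w < u})"
    using assms(5) distinct(1) unfolding ball_simps below by simp
  then have "\<exists>c. \<forall>u\<in>{x, y, z}. even (c + u + card {w \<in> {x, y, z}. w < u})" ..
  moreover have "(x + 1) mod n = x + 1" "(y + 1) mod n = y + 1"
    "(z + 1) mod n = (if z + 1 = n then 0 else z + 1)"
    using assms(2,3,7) by auto
  then have "\<forall>u\<in>{x, y, z}. (u + 1) mod n \<notin> {x, y, z}"
    using assms(2-4) by (cases "z + 1 = n") simp_all
  ultimately show ?thesis
    using assms(1-3,7) distinct unfolding exposable_def by simp
qed

section \<open>Large vertex sets contain exposable sets\<close>

text \<open>The positions of the members of \<open>T\<close> when counting starts at the vertex \<open>r\<close>.\<close>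

definition rotated :: "nat \<Rightarrow> nat \<Rightarrow> nat set \<Rightarrow> nat set" where
  "rotated n r T = {t. t < n \<and> (r + t) mod n \<in> T}"

lemma card_rotated:
  assumes "T \<subseteq> {..<n}"
  shows "card (rotated n r T) = card T"
proof -
  have "(\<lambda>t. (r + t) mod n) ` rotated n r T = (\<lambda>t. (r + t) mod n) ` {..<n} \<inter> T"
    by (auto simp: rotated_def)
  then have "(\<lambda>t. (r + t) mod n) ` rotated n r T = T"
    using assms by (simp add: shift_mod_image Int_absorb1)
  moreover have "inj_on (\<lambda>t. (r + t) mod n) (rotated n r T)"
    by (rule inj_on_subset[OF inj_on_shift_mod]) (auto simp: rotated_def)
  ultimately show ?thesis
    by (metis card_image)
qed

text \<open>If the predecessor of each vertex of \<open>T\<close> were in \<open>T\<close>, walking backwards from one vertex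
  of \<open>T\<close> would show that all vertices are in \<open>T\<close>.\<close>

lemma exists_initial_vertex:
  assumes "T \<subseteq> {..<n}" "T \<noteq> {}" "T \<noteq> {..<n}"
  shows "\<exists>r. 0 \<in> rotated n r T \<and> n - 1 \<notin> rotated n r T"
proof (rule ccontr)
  assume none: "\<not> ?thesis"
  have n: "n > 0"
    using assms(1,2) by auto
  have step: "(t + (n - 1)) mod n \<in> T" if "t \<in> T" for t
    using none n that assms(1) by (auto simp: rotated_def)
  obtain t where t: "t \<in> T"
    using assms(2) by blast
  have retreat: "(t + k * (n - 1)) mod n \<in> T" for k
  proof (induction k)
    case 0
    then show ?case
      using t assms(1) by auto
  next
    case (Suc k)
    have "((t + k * (n - 1)) mod n + (n - 1)) mod n = (t + Suc k * (n - 1)) mod n"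
      unfolding mod_add_left_eq by (simp add: ac_simps)
    with step[OF Suc] show ?case
      by simp
  qed
  have "v \<in> T" if v: "v < n" for v
  proof -
    \<comment> \<open>The number of backward steps from \<open>t\<close> to \<open>v\<close>, plus \<open>n\<close> to avoid truncated subtraction.\<close>
    define k where "k = t + (n - v)"
    have "t + k * (n - 1) + k = t + k * n"
      using n by (cases n) (auto simp: algebra_simps)
    also have "\<dots> = v + (k - 1) * n + k"
    proof -
      have "k = (k - 1) + 1" "v + k = t + n"
        using v by (simp_all add: k_def)
      then have "k * n = (k - 1) * n + n"
        by (metis add_mult_distrib mult_1)
      with \<open>v + k = t + n\<close> show ?thesis
        by simp
    qed
    finally have "t + k * (n - 1) = v + (k - 1) * n"
      by simp
    then show ?thesis
      using retreat[of k] v by simp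
  qed
  with assms(1,3) show False
    by auto
qed

text \<open>Number the vertices from some vertex \<open>0\<close> in \<open>T\<close> whose predecessor is not in \<open>T\<close>.  An odd member
  other than 1 forms a pair with 0.  If there is none, then 1 must be in \<open>T\<close>, since there are too few even
  vertices, and it forms a pair with any even member beyond 2.\<close>

lemma exposable_pair_in_large_set:
  assumes n: "even n" "n \<ge> 6" and T: "T \<subseteq> {..<n}" "card T > n div 2"
  shows "\<exists>r x y. x \<in> rotated n r T \<and> y \<in> rotated n r T \<and> x \<noteq> y \<and> exposable n {x, y}"
proof (cases "T = {..<n}")
  case True
  have "exposable n {0, 3}"
    using n by (intro exposable_pair) auto
  moreover have "0 \<in> rotated n 0 T" "3 \<in> rotated n 0 T"
    using True n by (auto simp: rotated_def)
  ultimately show ?thesis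
    by (metis zero_neq_numeral)
next
  case False
  have "T \<noteq> {}"
    using T(2) by auto
  then obtain r where r: "0 \<in> rotated n r T" "n - 1 \<notin> rotated n r T"
    using exists_initial_vertex[OF T(1)] False by blast
  define R where "R = rotated n r T"
  have R: "R \<subseteq> {..<n}" "card R > n div 2"
    using T card_rotated by (auto simp: R_def rotated_def)
  have less: "t + 2 \<le> n" if "t \<in> R" for t
  proof -
    have "t < n" "t \<noteq> n - 1"
      using that R(1) r(2) by (auto simp: R_def)
    then show ?thesis
      by simp
  qed
  have "\<exists>x y. x \<in> R \<and> y \<in> R \<and> x + 3 \<le> y \<and> y + 3 \<le> x + n \<and> odd (x + y)"
  proof (cases "\<exists>y\<in>R. odd y \<and> y \<noteq> 1")
    case True
    then obtain y where y: "y \<in> R" "odd y" "y \<noteq> 1"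
      by blast
    then have "0 + 3 \<le> y" "y + 3 \<le> 0 + n"
      using less[OF y(1)] n by presburger+
    with y r(1) show ?thesis
      unfolding R_def by fastforce
  next
    case no_odd: False
    have "card R > card ((*) 2 ` {..<n div 2})"
      using R(2) by (simp add: card_image inj_on_def)
    then have "\<not> R \<subseteq> (*) 2 ` {..<n div 2}"
      using card_mono[of "(*) 2 ` {..<n div 2}" R] by auto
    then obtain t where "t \<in> R" "t \<notin> (*) 2 ` {..<n div 2}"
      by blast
    then have "odd t"
      using less[of t] by (auto elim!: evenE)
    then have one: "1 \<in> R"
      using no_odd \<open>t \<in> R\<close> by metis
    have "card R > card {0, 1, 2::nat}"
      using R(2) n by simp
    then have "\<not> R \<subseteq> {0, 1, 2}"
      using card_mono[of "{0, 1, 2::nat}" R] by auto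
    then obtain y where y: "y \<in> R" "y \<notin> {0, 1, 2}"
      by blast
    then have "even y"
      using no_odd by auto
    then have "1 + 3 \<le> y" "y + 3 \<le> 1 + n"
      using y(2) less[OF y(1)] by (auto elim!: evenE)
    with y one \<open>even y\<close> show ?thesis
      by fastforce
  qed
  then obtain x y where xy: "x \<in> R" "y \<in> R" "x + 3 \<le> y" "y + 3 \<le> x + n" "odd (x + y)"
    by blast
  then have "exposable n {x, y}"
    using R(1) n by (intro exposable_pair) auto
  with xy show ?thesis
    unfolding R_def by (metis add_leD2 add_le_same_cancel1 not_numeral_le_zero)
qed

text \<open>The triple is \<open>{0, y, z}\<close>.  If it does not exist, every even member is at most \<open>y + 1\<close> for every odd
  member \<open>y\<close>.  Then halving the even members and sending an odd \<open>y\<close> to \<open>(y + 3) / 2\<close>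
  puts the odd members beyond the even ones and packs all of them into \<open>{0..m + 1}\<close>.\<close>

lemma odd_gaps_from_isolated_vertex:
  assumes R: "R \<subseteq> {..<2 * m + 1}" "card R \<ge> m + 3" and iso: "0 \<in> R" "1 \<notin> R" "2 * m \<notin> R"
  shows "\<exists>y\<in>R. \<exists>z\<in>R. 3 \<le> y \<and> y + 3 \<le> z \<and> z + 3 \<le> 2 * m + 1 \<and> odd y \<and> even z"
proof -
  have "\<exists>y\<in>R. \<exists>z\<in>R. y + 3 \<le> z \<and> odd y \<and> even z"
  proof (rule ccontr)
    assume "\<not> ?thesis"
    then have close: "z < y + 3" if "y \<in> R" "z \<in> R" "odd y" "even z" for y z
      using that not_less by blast
    define f where "f t = (if even t then t div 2 else (t + 3) div 2)" for t :: nat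
    have "inj_on f R"
    proof (rule inj_onI)
      fix s t assume st: "s \<in> R" "t \<in> R" "f s = f t"
      then show "s = t"
        using close[of s t] close[of t s] unfolding f_def
        by (auto split: if_splits elim!: evenE oddE)
    qed
    moreover have "f ` R \<subseteq> {..m + 1}"
      using R(1) iso(3) by (auto simp: f_def elim!: evenE oddE)
    ultimately have "card R \<le> card {..m + 1}"
      by (intro card_inj_on_le) auto
    with R(2) show False
      by simp
  qed
  then obtain y z where yz: "y \<in> R" "z \<in> R" "y + 3 \<le> z" "odd y" "even z"
    by blast
  have "3 \<le> y"
    using yz(1,4) iso(2) by (cases "y = 1") (auto elim!: oddE)
  moreover have "z + 3 \<le> 2 * m + 1"
  proof -
    have "z < 2 * m + 1" "z \<noteq> 2 * m"
      using yz(2) iso(3) R(1) by auto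
    with yz(5) show ?thesis
      by presburger
  qed
  ultimately show ?thesis
    using yz by blast
qed

text \<open>Any \<open>y \<in> R\<close> with \<open>3 \<le> y \<le> e - 3\<close> can serve as the middle vertex: one of 0 and 1, and one of \<open>e - 1\<close>
  and \<open>e\<close>, have the right parity.  At most six members of \<open>R\<close> are outside that range.\<close>

lemma odd_gaps_between_edges:
  fixes R :: "nat set"
  assumes R: "card R \<ge> 7" and ends: "0 \<in> R" "1 \<in> R" "e - 1 \<in> R" "e \<in> R"
    and e: "\<And>t. t \<in> R \<Longrightarrow> t \<le> e"
  shows "\<exists>x\<in>R. \<exists>y\<in>R. \<exists>z\<in>R. x + 3 \<le> y \<and> y + 3 \<le> z \<and> odd (x + y) \<and> odd (y + z)"
proof -
  have "card {0, 1, 2, e - 2, e - 1, e} \<le> 6"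
    by (simp add: card_insert_if)
  then have "\<not> R \<subseteq> {0, 1, 2, e - 2, e - 1, e}"
    using card_mono[of "{0, 1, 2, e - 2, e - 1, e}" R] R by auto
  then obtain y where y: "y \<in> R" "y \<notin> {0, 1, 2, e - 2, e - 1, e}"
    by blast
  then have y3: "3 \<le> y" "y + 3 \<le> e"
    using e[OF y(1)] by auto
  define x where "x = (if odd y then 0 else 1 :: nat)"
  define z where "z = (if odd (y + e) then e else e - 1)"
  have "x \<in> R" "z \<in> R"
    using ends by (simp_all add: x_def z_def)
  moreover have "x + 3 \<le> y" "odd (x + y)"
    using y3 by (auto simp: x_def elim!: evenE)
  moreover have "y + 3 \<le> z" "odd (y + z)"
    using y3 unfolding z_def by presburger+
  ultimately show ?thesis
    using y(1) by blast
qed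

text \<open>After cutting the cycle before a first vertex of \<open>T\<close>, either the first or the last member of
  \<open>T\<close> is isolated in \<open>T\<close>, or both belong to adjacent pairs; the two preceding lemmas treat these cases.\<close>

lemma exposable_triple_in_large_set:
  assumes n: "n = 2 * m + 1" "m \<ge> 4" and T: "T \<subseteq> {..<n}" "card T \<ge> m + 3"
  shows "\<exists>r x y z. {x, y, z} \<subseteq> rotated n r T \<and> card {x, y, z} = 3 \<and> exposable n {x, y, z}"
proof -
  have triple: ?thesis
    if "x \<in> rotated n r T" "y \<in> rotated n r T" "z \<in> rotated n r T" "x + 3 \<le> y" "y + 3 \<le> z"
      "z + 3 \<le> x + n" "odd (x + y)" "odd (y + z)" for r x y z
  proof -
    have "exposable n {x, y, z}"
      using that n by (intro exposable_triple) (auto simp: rotated_def)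
    moreover have "card {x, y, z} = 3"
      using that by simp
    ultimately show ?thesis
      using that by blast
  qed
  have isolated: ?thesis
    if "0 \<in> rotated n r T" "1 \<notin> rotated n r T" "n - 1 \<notin> rotated n r T" for r
  proof -
    have "rotated n r T \<subseteq> {..<2 * m + 1}" "card (rotated n r T) \<ge> m + 3"
      "0 \<in> rotated n r T" "1 \<notin> rotated n r T" "2 * m \<notin> rotated n r T"
      using n card_rotated T that by (auto simp: rotated_def)
    then obtain y z where "y \<in> rotated n r T" "z \<in> rotated n r T" "3 \<le> y" "y + 3 \<le> z"
      "z + 3 \<le> n" "odd y" "even z"
      using odd_gaps_from_isolated_vertex[of "rotated n r T" m] unfolding n(1) by blast
    then show ?thesis
      using that(1) triple[of 0 r y z] by simp
  qed
  show ?thesis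
  proof (cases "T = {..<n}")
    case True
    show ?thesis
      by (rule triple[of 0 0 3 6]) (use True n in \<open>auto simp: rotated_def\<close>)
  next
    case False
    have "T \<noteq> {}"
      using T(2) by auto
    then obtain r where r: "0 \<in> rotated n r T" "n - 1 \<notin> rotated n r T"
      using exists_initial_vertex[OF T(1)] False by blast
    define R where "R = rotated n r T"
    have R: "R \<subseteq> {..<n}" "card R \<ge> 7" "finite R"
      using T n card_rotated finite_subset by (auto simp: R_def rotated_def)
    define e where "e = Max R"
    have e: "e \<in> R" "\<And>t. t \<in> R \<Longrightarrow> t \<le> e"
    proof -
      have "R \<noteq> {}"
        using R(2) by auto
      with R(3) show "e \<in> R"
        unfolding e_def by (rule Max_in)
      show "t \<le> e" if "t \<in> R" for t
        unfolding e_def using R(3) that by (rule Max_ge)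
    qed
    have e1: "e + 1 < n"
    proof -
      have "e < n" "e \<noteq> n - 1"
        using R(1) e(1) r(2) by (auto simp: R_def)
      then show ?thesis
        by simp
    qed
    have "e \<noteq> 0"
    proof
      assume "e = 0"
      then have "R \<subseteq> {0}"
        using e(2) by auto
      then have "card R \<le> 1"
        using card_mono[of "{0::nat}" R] by simp
      with R(2) show False
        by simp
    qed
    consider "1 \<notin> R" | "e - 1 \<notin> R" | "1 \<in> R" "e - 1 \<in> R"
      by blast
    then show ?thesis
    proof cases
      case 1
      then show ?thesis
        using isolated r by (simp add: R_def)
    next
      case 2
      have shift: "t \<in> rotated n (r + e) T \<longleftrightarrow> (e + t) mod n \<in> R" if "t < n" for t
        using that by (auto simp: rotated_def R_def mod_add_right_eq ac_simps)
      have "e + (n - 1) = e - 1 + n"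
        using \<open>e \<noteq> 0\<close> e1 by simp
      then have "(e + (n - 1)) mod n = (e - 1) mod n"
        by (metis mod_add_self2)
      also have "\<dots> = e - 1"
        using e1 by simp
      finally have pred: "(e + (n - 1)) mod n = e - 1" .
      have "e + 1 \<notin> R"
        using e(2)[of "e + 1"] by auto
      then show ?thesis
        using isolated[of "r + e"] shift[of 0] shift[of 1] shift[of "n - 1"] 2 e(1) e1 pred
        by simp
    next
      case 3
      obtain x y z where xyz: "x \<in> R" "y \<in> R" "z \<in> R" "x + 3 \<le> y" "y + 3 \<le> z"
        "odd (x + y)" "odd (y + z)"
        using odd_gaps_between_edges[OF R(2) _ 3 e] r(1) unfolding R_def by blast
      \<comment> \<open>The remaining distance \<open>n + x - z\<close> is odd, so it is at least 3 once it exceeds 1.\<close>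
      have "z + 2 \<le> n"
        using e(2)[OF xyz(3)] e1 by simp
      moreover have "z + 2 \<noteq> x + n" if "x = 0"
        using that xyz(6,7) n by presburger
      ultimately have "z + 3 \<le> x + n"
        by (cases "x = 0") auto
      with xyz show ?thesis
        unfolding R_def by (intro triple)
    qed
  qed
qed

section \<open>The defect of a cycle\<close>

text \<open>No matching is larger than \<open>n div 2\<close>, so this lower bound fixes the size.\<close>

lemma equimatchable_cycleI:
  assumes "S \<subseteq> {..<n}" "n \<ge> 3"
    and "\<And>M. maximal_matching (cycle_edges n) M \<Longrightarrow> covers M S \<Longrightarrow> n div 2 \<le> card M"
  shows "equimatchable (cycle_verts n) (cycle_edges n) S"
proof -
  have "card M = n div 2" if "maximal_matching (cycle_edges n) M" "covers M S" for M
    using cycle_matching_card_le[OF assms(2) that(1)] assms(3)[OF that] by simp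
  then show ?thesis
    using assms(1) by (simp add: equimatchable_def cycle_verts_def)
qed

lemma equimatch_defect_eqI:
  assumes "equimatchable V E S" "card S = k" "\<And>S. equimatchable V E S \<Longrightarrow> k \<le> card S"
  shows "equimatch_defect V E = k"
  unfolding equimatch_defect_def using assms by (intro Least_equality) auto

lemma equimatch_defect_small_cycle:
  assumes "n \<in> {3, 4, 5, 7}"
  shows "equimatch_defect (cycle_verts n) (cycle_edges n) = 0"
proof (rule equimatch_defect_eqI)
  show "equimatchable (cycle_verts n) (cycle_edges n) {}"
  proof (rule equimatchable_cycleI)
    fix M assume "maximal_matching (cycle_edges n) M"
    then have "n \<le> 3 * card M"
      using assms by (intro cycle_maximal_matching_card_ge) auto
    then show "n div 2 \<le> card M"
      using assms by auto
  qed (use assms in auto)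
qed auto

lemma equimatch_defect_even_cycle:
  assumes n: "even n" "n \<ge> 6"
  shows "equimatch_defect (cycle_verts n) (cycle_edges n) = n div 2"
proof (rule equimatch_defect_eqI)
  let ?S = "(*) 2 ` {..<n div 2}"
  show "card ?S = n div 2"
    by (simp add: card_image inj_on_def)
  show "equimatchable (cycle_verts n) (cycle_edges n) ?S"
  proof (rule equimatchable_cycleI)
    fix M assume M: "maximal_matching (cycle_edges n) M" "covers M ?S"
    then have mat: "matching (cycle_edges n) M"
      by (simp add: maximal_matching_def)
    have fin: "finite M"
      using matching_card_Union(2)[OF simple_graph_cycle mat] n by simp
    have "card ?S \<le> card {e \<in> M. e \<inter> ?S \<noteq> {}}"
    proof (rule card_independent_covered_le[OF fin M(2)])
      fix e u v assume "e \<in> M" and uv: "u \<in> ?S \<inter> e" "v \<in> ?S \<inter> e"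
      then obtain i where i: "i < n" "e = {i, (i + 1) mod n}"
        using mat by (auto simp: matching_def cycle_edges_def)
      have "even ((i + 1) mod n) \<longleftrightarrow> odd i"
        using n(1) by (simp add: even_mod_2_iff dvd_mod_iff)
      moreover have "even u" "even v"
        using uv by auto
      ultimately show "u = v"
        using uv unfolding i(2) by auto
    qed
    also have "\<dots> \<le> card M"
      using fin by (intro card_mono) auto
    finally show "n div 2 \<le> card M"
      by (simp add: card_image inj_on_def)
  qed (use n in auto)
  fix S assume S: "equimatchable (cycle_verts n) (cycle_edges n) S"
  show "n div 2 \<le> card S"
  proof (rule ccontr)
    assume small: "\<not> ?thesis"
    have sub: "S \<subseteq> {..<n}"
      using S by (simp add: equimatchable_def cycle_verts_def)
    then have "card ({..<n} - S) = n - card S"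
      by (simp add: card_Diff_subset finite_subset)
    then have "card ({..<n} - S) > n div 2"
      using small by simp
    then obtain r x y where xy: "x \<in> rotated n r ({..<n} - S)" "y \<in> rotated n r ({..<n} - S)"
      "x \<noteq> y" "exposable n {x, y}"
      using exposable_pair_in_large_set[OF n Diff_subset] by metis
    have "card {x, y} = card ({} :: nat set)"
      using equimatchable_cycle_exposable_card_eq[OF _ S xy(4) _ exposable_empty[OF n(1)], of r] n xy
      by (auto simp: rotated_def)
    with xy(3) show False
      by simp
  qed
qed

lemma equimatch_defect_odd_cycle:
  assumes n: "n = 2 * m + 1" "m \<ge> 4"
  shows "equimatch_defect (cycle_verts n) (cycle_edges n) = m - 1"
proof (rule equimatch_defect_eqI)
  let ?S = "(*) 2 ` {..<m - 1}"
  have card_S: "card ?S = m - 1"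
    by (simp add: card_image inj_on_def)
  then show "card ?S = m - 1" .
  show "equimatchable (cycle_verts n) (cycle_edges n) ?S"
  proof (rule equimatchable_cycleI)
    fix M assume M: "maximal_matching (cycle_edges n) M" "covers M ?S"
    then have mat: "matching (cycle_edges n) M"
      by (simp add: maximal_matching_def)
    have fin: "finite M"
      using matching_card_Union(2)[OF simple_graph_cycle mat] n by simp
    have succ: "(i + 1) mod n = (if i = 2 * m then 0 else i + 1)" if "i < n" for i
      using that n by auto
    have "card ?S \<le> card {e \<in> M. e \<inter> ?S \<noteq> {}}"
    proof (rule card_independent_covered_le[OF fin M(2)])
      fix e u v assume "e \<in> M" and uv: "u \<in> ?S \<inter> e" "v \<in> ?S \<inter> e"
      then obtain i where i: "i < n" "e = {i, (i + 1) mod n}"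
        using mat by (auto simp: matching_def cycle_edges_def)
      have "even u" "even v" "u < 2 * m" "v < 2 * m"
        using uv by auto
      then show "u = v"
        using uv i succ[OF i(1)] by (auto split: if_splits)
    qed
    also have "\<dots> < card M"
    proof (rule psubset_card_mono[OF fin])
      \<comment> \<open>Neither this edge nor its two neighbours on the cycle meet the covered set, and the matching
        contains one of these three edges.\<close>
      have "{2 * m - 2, 2 * m - 2 + 1} \<in> cycle_edges n"
        using n by (force simp: cycle_edges_def)
      then obtain f where f: "f \<in> M" "{2 * m - 2, 2 * m - 2 + 1} \<inter> f \<noteq> {}"
        using M(1) unfolding maximal_matching_iff[OF empty_notin_cycle_edges] by blast
      then obtain i where i: "i < n" "f = {i, (i + 1) mod n}"
        using mat by (auto simp: matching_def cycle_edges_def)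
      have "i = 2 * m - 3 \<or> i = 2 * m - 2 \<or> i = 2 * m - 1"
        using f(2) n unfolding i(2) succ[OF i(1)] by (auto split: if_splits)
      then have "f \<subseteq> {2 * m - 3..}"
        using n unfolding i(2) succ[OF i(1)] by auto
      moreover have "s < 2 * m - 3" if "s \<in> ?S" for s
        using that n by auto
      ultimately have "f \<inter> ?S = {}"
        by fastforce
      with f(1) show "{e \<in> M. e \<inter> ?S \<noteq> {}} \<subset> M"
        by blast
    qed
    finally show "n div 2 \<le> card M"
      using card_S n by simp
  qed (use n in auto)
  fix S assume S: "equimatchable (cycle_verts n) (cycle_edges n) S"
  show "m - 1 \<le> card S"
  proof (rule ccontr)
    assume small: "\<not> ?thesis"
    have sub: "S \<subseteq> {..<n}"
      using S by (simp add: equimatchable_def cycle_verts_def)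
    then have "card ({..<n} - S) = n - card S"
      by (simp add: card_Diff_subset finite_subset)
    then have "card ({..<n} - S) \<ge> m + 3"
      using small n by simp
    then obtain r x y z where xyz: "{x, y, z} \<subseteq> rotated n r ({..<n} - S)"
      "card {x, y, z} = 3" "exposable n {x, y, z}"
      using exposable_triple_in_large_set[OF n Diff_subset] by metis
    \<comment> \<open>A vertex outside \<open>S\<close>; by itself it is exposable and competes with the triple.\<close>
    define q where "q = (r + x) mod n"
    have "(q + w) mod n \<notin> S" if "w \<in> {0}" for w
      using xyz(1) that by (auto simp: q_def rotated_def)
    moreover have "exposable n {0}"
      using n by (intro exposable_singleton) auto
    moreover have "(r + u) mod n \<notin> S" if "u \<in> {x, y, z}" for u
      using xyz(1) that by (auto simp: rotated_def)
    ultimately have "card {x, y, z} = card {0::nat}"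
      using n by (intro equimatchable_cycle_exposable_card_eq[OF _ S xyz(3)]) auto
    with xyz(2) show False
      by simp
  qed
qed

theorem theorem3p10:
  fixes n :: nat
  assumes "n \<ge> 3"
  shows "(n \<in> {3, 4, 5, 7} \<longrightarrow> equimatch_defect (cycle_verts n) (cycle_edges n) = 0)
    \<and> (n \<ge> 6 \<and> even n \<longrightarrow>
         real (equimatch_defect (cycle_verts n) (cycle_edges n)) = real n / 2)
    \<and> (n \<ge> 9 \<and> odd n \<longrightarrow>
         real (equimatch_defect (cycle_verts n) (cycle_edges n)) = (real n - 3) / 2)"
proof (intro conjI impI)
  assume "n \<in> {3, 4, 5, 7}"
  then show "equimatch_defect (cycle_verts n) (cycle_edges n) = 0"
    by (rule equimatch_defect_small_cycle)
next
  assume "n \<ge> 6 \<and> even n"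
  then show "real (equimatch_defect (cycle_verts n) (cycle_edges n)) = real n / 2"
    by (auto simp: equimatch_defect_even_cycle elim!: evenE)
next
  assume n: "n \<ge> 9 \<and> odd n"
  then obtain m where m: "n = 2 * m + 1"
    by (auto elim: oddE)
  then have "m \<ge> 4"
    using n by simp
  then show "real (equimatch_defect (cycle_verts n) (cycle_edges n)) = (real n - 3) / 2"
    using equimatch_defect_odd_cycle[OF m] m by (simp add: of_nat_diff)
qed

end
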